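(* Let $(a_1,i_1),(a_1,j_1),(a_2,i_2),(a_2,j_2)\in[n]^2$ be distinct, with $a_1\neq a_2$, and let $u\in S([n]^2)$ be the product of two transpositions $$u:=\big((a_1,i_1),(a_1,j_1)\big)\,\big((a_2,i_2),(a_2,j_2)\big).$$ Then $u$ is stable of rank $1$ if and only if either $\{a_1,a_2\}\cap\{i_1,j_1,i_2,j_2\}=\emptyset$ or $\{a_1,a_2\}=\{i_1,j_1,i_2,j_2\}$. In particular, there are exactly $$\binom{n}{2}\left(\binom{n-2}{2}^2+1\right)$$ such permutations (i.e. permutations $u\in S([n]^2)$ that are stable of rank $1$ and can be written as $u=\big((a_1,i_1),(a_1,j_1)\big)\,\big((a_2,i_2),(a_2,j_2)\big)$ for some distinct $(a_1,i_1),(a_1,j_1),(a_2,i_2),(a_2,j_2)\in[n]^2$ with $a_1\neq a_2$).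
   Context: $[n]=\{1,\dots,n\}$; $S(A)$ is the symmetric group on a set $A$; permutations are written in disjoint cycle form and composed right to left. For $u\in S([n]^t)$ and $v\in S([n]^r)$, the tensor product $u\otimes v\in S([n]^{t+r})$ is $(u\otimes v)(\alpha,\beta)=(u(\alpha),v(\beta))$; $1$ denotes the identity of $S_n=S([n])$. For $u\in S([n]^t)$ define $\psi_0(u):=u^{-1}$ and, for $k\ge1$, $$\psi_k(u)=\prod_{i=0}^{k}\big(1^{\otimes(k-i)}\otimes u^{-1}\otimes 1^{\otimes i}\big)\ \prod_{i=1}^{k}\big(1^{\otimes i}\otimes u\otimes 1^{\otimes(k-i)}\big)\in S([n]^{t+k}),$$ factors being written from left to right in increasing order of $i$. The permutation $u$ is stable if there is an integer $k\ge1$ such that $\psi_{k+h}(u)=\psi_{k-1}(u)\otimes 1^{\otimes(h+1)}$ for all $h\ge0$; the rank of $u$ is the least such $k$. *)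

theory Defs
  imports "HOL-Combinatorics.Permutations"
begin

text \<open>
  The set \<open>[n]\<^sup>t\<close> is modelled by the lists of length \<open>t\<close> over \<open>{1..n}\<close>. An element of \<open>S([n]\<^sup>t)\<close> is
  a function \<open>u\<close> with \<open>u permutes words n t\<close>, so it fixes every list outside \<open>words n t\<close>
  and equality of permutations is equality of functions.
\<close>

definition words :: "nat \<Rightarrow> nat \<Rightarrow> nat list set" where
  "words n t = {w. length w = t \<and> set w \<subseteq> {1..n}}"

text \<open>
  The arguments \<open>t\<close> and \<open>r\<close> record that \<open>u\<close> acts on \<open>[n]\<^sup>t\<close> and \<open>v\<close> on \<open>[n]\<^sup>r\<close>.
\<close>

definition tensor ::
    "nat \<Rightarrow> nat \<Rightarrow> nat \<Rightarrow> (nat list \<Rightarrow> nat list) \<Rightarrow> (nat list \<Rightarrow> nat list) \<Rightarrow> nat list \<Rightarrow> nat list" where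
  "tensor n t r u v = (\<lambda>w. if w \<in> words n (t + r) then u (take t w) @ v (drop t w) else w)"

text \<open>
  \<open>1\<^sup>\<otimes>\<^sup>p \<otimes> v \<otimes> 1\<^sup>\<otimes>\<^sup>q\<close>. Every tensor power of the identity of \<open>S([n])\<close>, including the
  empty one in \<open>S([n]\<^sup>0)\<close>, is the function \<open>id\<close>.
\<close>

definition pad ::
    "nat \<Rightarrow> nat \<Rightarrow> nat \<Rightarrow> nat \<Rightarrow> (nat list \<Rightarrow> nat list) \<Rightarrow> nat list \<Rightarrow> nat list" where
  "pad n t p q v = tensor n p (t + q) id (tensor n t q v id)"

text \<open>The head of the list is the leftmost factor, that is, the one applied last.\<close>

definition perm_prod :: "('a \<Rightarrow> 'a) list \<Rightarrow> 'a \<Rightarrow> 'a" where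
  "perm_prod fs = foldr (\<circ>) fs id"

definition psi ::
    "nat \<Rightarrow> nat \<Rightarrow> nat \<Rightarrow> (nat list \<Rightarrow> nat list) \<Rightarrow> nat list \<Rightarrow> nat list" where
  "psi n t k u =
    (if k = 0 then inv u
     else perm_prod (map (\<lambda>i. pad n t (k - i) i (inv u)) [0..<Suc k]) \<circ>
          perm_prod (map (\<lambda>i. pad n t i (k - i) u) [1..<Suc k]))"

definition stable_at :: "nat \<Rightarrow> nat \<Rightarrow> (nat list \<Rightarrow> nat list) \<Rightarrow> nat \<Rightarrow> bool" where
  "stable_at n t u k \<longleftrightarrow>
    k \<ge> 1 \<and> (\<forall>h. psi n t (k + h) u = tensor n (t + (k - 1)) (h + 1) (psi n t (k - 1) u) id)"

definition stable_perm :: "nat \<Rightarrow> nat \<Rightarrow> (nat list \<Rightarrow> nat list) \<Rightarrow> bool" where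
  "stable_perm n t u \<longleftrightarrow> (\<exists>k. stable_at n t u k)"

text \<open>Meaningful only for stable \<open>u\<close>.\<close>

definition stable_rank :: "nat \<Rightarrow> nat \<Rightarrow> (nat list \<Rightarrow> nat list) \<Rightarrow> nat" where
  "stable_rank n t u = (LEAST k. stable_at n t u k)"

end

theory Submission imports Defs begin

text \<open>
  Write \<open>A\<^sub>i\<close> for \<open>1\<^sup>\<otimes>\<^sup>i \<otimes> u \<otimes> 1\<^bsup>\<otimes>(k-i)\<^esup>\<close>. Then \<open>\<psi>\<^sub>k(u)\<close> is the conjugate of \<open>A\<^sub>0\<close> inverse by \<open>A\<^sub>1 \<dots> A\<^sub>k\<close>.
  For \<open>u\<close> in \<open>S([n]\<^sup>2)\<close> the permutation \<open>A\<^sub>0\<close> always commutes with \<open>A\<^sub>2, \<dots>, A\<^sub>k\<close>, so \<open>u\<close> is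
  stable of rank 1 iff \<open>u \<otimes> 1\<close> and \<open>1 \<otimes> u\<close> commute. If moreover \<open>u(x,y) = (x, f\<^sub>x(y))\<close>, this says
  that \<open>f\<close> is constant on the orbits of every \<open>f\<^sub>x\<close>. For the two transpositions at hand, \<open>f\<close> must
  agree at \<open>i\<^sub>1, j\<^sub>1\<close> and at \<open>i\<^sub>2, j\<^sub>2\<close>, and it is the identity exactly off \<open>{a\<^sub>1, a\<^sub>2}\<close>.
  The count runs over the normal forms with \<open>a\<^sub>1 < a\<^sub>2\<close>, \<open>i\<^sub>1 < j\<^sub>1\<close>, \<open>i\<^sub>2 < j\<^sub>2\<close>, which \<open>u\<close> determines.
\<close>

section \<open>Padded permutations acting on words\<close>

lemma pad_outside: "w \<notin> words n (p + t + q) \<Longrightarrow> pad n t p q v w = w"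
  by (simp add: pad_def tensor_def add.assoc)

lemma pad_append:
  assumes "x \<in> words n p" "y \<in> words n t" "z \<in> words n q"
  shows "pad n t p q v (x @ y @ z) = x @ v y @ z"
proof -
  have "length x = p" "length y = t" "length z = q"
    using assms by (auto simp: words_def)
  moreover have "y @ z \<in> words n (t + q)" "x @ y @ z \<in> words n (p + (t + q))"
    using assms by (auto simp: words_def)
  ultimately show ?thesis by (simp add: pad_def tensor_def)
qed

lemma words_splitE:
  assumes "w \<in> words n (p + q)"
  obtains x y where "w = x @ y" "x \<in> words n p" "y \<in> words n q"
proof
  show "w = take p w @ drop p w" by simp
  show "take p w \<in> words n p" "drop p w \<in> words n q"
    using assms by (auto simp: words_def dest: in_set_takeD in_set_dropD)
qed

lemma words_split3E:
  assumes "w \<in> words n (p + t + q)"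
  obtains x y z where "w = x @ y @ z" "x \<in> words n p" "y \<in> words n t" "z \<in> words n q"
  by (metis append.assoc assms words_splitE)

lemma pad_in_words:
  assumes "v permutes words n t" "w \<in> words n (p + t + q)"
  shows "pad n t p q v w \<in> words n (p + t + q)"
proof -
  obtain x y z where w: "w = x @ y @ z" "x \<in> words n p" "y \<in> words n t" "z \<in> words n q"
    using assms(2) by (rule words_split3E)
  then have "v y \<in> words n t" using assms(1) by (simp add: permutes_in_image)
  then show ?thesis using w by (auto simp: pad_append) (auto simp: words_def)
qed

lemma pad_comp:
  assumes "v permutes words n t"
  shows "pad n t p q u \<circ> pad n t p q v = pad n t p q (u \<circ> v)"
proof
  fix w
  show "(pad n t p q u \<circ> pad n t p q v) w = pad n t p q (u \<circ> v) w"
  proof (cases "w \<in> words n (p + t + q)")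
    case True
    then obtain x y z where w: "w = x @ y @ z" "x \<in> words n p" "y \<in> words n t" "z \<in> words n q"
      by (rule words_split3E)
    moreover have "v y \<in> words n t" using w assms by (simp add: permutes_in_image)
    ultimately show ?thesis by (simp add: pad_append)
  qed (simp add: pad_outside)
qed

lemma pad_id: "pad n t p q id = id"
proof
  fix w
  show "pad n t p q id w = id w"
    by (cases "w \<in> words n (p + t + q)") (auto simp: pad_append pad_outside elim!: words_split3E)
qed

lemma pad_inv:
  assumes "u permutes words n t"
  shows "pad n t p q (inv u) \<circ> pad n t p q u = id" "pad n t p q u \<circ> pad n t p q (inv u) = id"
  using assms by (simp_all add: pad_comp permutes_inv permutes_inv_o pad_id)

lemma pad_0: "pad n t 0 q v = tensor n t q v id"
  by (auto simp: pad_def tensor_def fun_eq_iff)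

text \<open>Lets identities on short words carry over to longer ones: letters to the right of the
  block that \<open>v\<close> moves are only copied.\<close>

lemma pad_snoc_word:
  assumes "w \<in> words n (p + t + q)" "z \<in> words n r"
  shows "pad n t p (q + r) v (w @ z) = pad n t p q v w @ z"
proof -
  obtain x y y' where w: "w = x @ y @ y'" "x \<in> words n p" "y \<in> words n t" "y' \<in> words n q"
    using assms(1) by (rule words_split3E)
  moreover have "y' @ z \<in> words n (q + r)" using w assms by (auto simp: words_def)
  ultimately show ?thesis using assms by (simp add: pad_append)
qed

text \<open>Since \<open>t \<le> i\<close>, the two blocks occupy disjoint positions, separated by a
  gap of \<open>i - t\<close> letters.\<close>

lemma pad_disjoint_commute:
  assumes u: "u permutes words n t" and v: "v permutes words n t" and "t \<le> i" "i \<le> k"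
  shows "pad n t 0 k u \<circ> pad n t i (k - i) v = pad n t i (k - i) v \<circ> pad n t 0 k u"
proof
  fix w
  show "(pad n t 0 k u \<circ> pad n t i (k - i) v) w = (pad n t i (k - i) v \<circ> pad n t 0 k u) w"
  proof (cases "w \<in> words n (t + k)")
    case True
    then have "w \<in> words n (t + (i - t) + (t + (k - i)))" using assms(3,4) by simp
    then obtain x y r where w1: "w = x @ y @ r" "x \<in> words n t" "y \<in> words n (i - t)"
        "r \<in> words n (t + (k - i))"
      by (rule words_split3E)
    then obtain z z' where w2: "r = z @ z'" "z \<in> words n t" "z' \<in> words n (k - i)"
      by (metis words_splitE)
    have 0: "pad n t 0 k u (a @ y @ b @ z') = u a @ y @ b @ z'"
      if "a \<in> words n t" "b \<in> words n t" for a b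
    proof -
      have "y @ b @ z' \<in> words n k" using that w1 w2 assms(3,4) by (auto simp: words_def)
      then show ?thesis using that pad_append[of "[]" n 0 a t "y @ b @ z'" k u]
        by (simp add: words_def)
    qed
    have 1: "pad n t i (k - i) v (a @ y @ b @ z') = a @ y @ v b @ z'"
      if "a \<in> words n t" "b \<in> words n t" for a b
    proof -
      have "a @ y \<in> words n i" using that w1 assms(3,4) by (auto simp: words_def)
      then show ?thesis using that w2 pad_append[of "a @ y" n i b t z' "k - i" v] by simp
    qed
    show ?thesis using w1 w2 u v by (simp add: 0 1 permutes_in_image)
  next
    case False
    then have "w \<notin> words n (0 + t + k)" "w \<notin> words n (i + t + (k - i))"
      using assms(3,4) by (auto simp: add.commute)
    then show ?thesis by (simp add: pad_outside)
  qed
qed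

text \<open>Both factors touch only the first three letters, so commutation on words of length 3
  extends over any \<open>h\<close> trailing letters.\<close>

lemma pad_overlap_commute:
  assumes u: "u permutes words n 2" and v: "v permutes words n 2"
    and comm: "pad n 2 0 1 u \<circ> pad n 2 1 0 v = pad n 2 1 0 v \<circ> pad n 2 0 1 u"
  shows "pad n 2 0 (1 + h) u \<circ> pad n 2 1 h v = pad n 2 1 h v \<circ> pad n 2 0 (1 + h) u"
proof
  fix w
  show "(pad n 2 0 (1 + h) u \<circ> pad n 2 1 h v) w = (pad n 2 1 h v \<circ> pad n 2 0 (1 + h) u) w"
  proof (cases "w \<in> words n (3 + h)")
    case True
    then obtain x z where w: "w = x @ z" "x \<in> words n 3" "z \<in> words n h"
      by (rule words_splitE)
    have "pad n 2 0 (1 + h) u (x @ z) = pad n 2 0 1 u x @ z"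
         "pad n 2 1 h v (x @ z) = pad n 2 1 0 v x @ z" if "x \<in> words n 3" for x
      using that w(3) pad_snoc_word[of x n 0 2 1 z h u] pad_snoc_word[of x n 1 2 0 z h v]
      by (simp_all add: numeral_3_eq_3)
    moreover have "pad n 2 0 1 u x \<in> words n 3" "pad n 2 1 0 v x \<in> words n 3"
      using w pad_in_words[OF u, of x 0 1] pad_in_words[OF v, of x 1 0] by (simp_all add: numeral_3_eq_3)
    ultimately show ?thesis using w fun_cong[OF comm, of x] by simp
  next
    case False
    then have "w \<notin> words n (0 + 2 + (1 + h))" "w \<notin> words n (1 + 2 + h)"
      by (simp_all add: numeral_3_eq_3)
    then show ?thesis by (simp add: pad_outside)
  qed
qed

section \<open>Stability of rank 1 as a commutation relation\<close>

lemma perm_prod_Cons: "perm_prod (f # fs) = f \<circ> perm_prod fs"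
  by (simp add: perm_prod_def)

lemma perm_prod_snoc: "perm_prod (fs @ [f]) = perm_prod fs \<circ> f"
proof -
  have "foldr (\<circ>) fs g = foldr (\<circ>) fs id \<circ> g" for g :: "'a \<Rightarrow> 'a"
    by (induction fs) (auto simp: comp_assoc)
  from this[of f] show ?thesis by (simp add: perm_prod_def)
qed

text \<open>The product is \<open>B k \<circ> ... \<circ> B 1 \<circ> B 0 \<circ> A 1 \<circ> ...
  \<circ> A k\<close>. Sliding \<open>B 0\<close> past the \<open>A i\<close> lets each
  \<open>B i\<close> cancel \<open>A i\<close>. The induction peels off the outermost factors
  \<open>B (Suc k)\<close> and \<open>A (Suc k)\<close>.\<close>

lemma perm_prod_conjugate:
  assumes "\<And>i. 1 \<le> i \<Longrightarrow> i \<le> k \<Longrightarrow> B i \<circ> A i = id"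
    and "\<And>i. 1 \<le> i \<Longrightarrow> i \<le> k \<Longrightarrow> B 0 \<circ> A i = A i \<circ> B 0"
  shows "perm_prod (map (\<lambda>i. B (k - i)) [0..<Suc k]) \<circ> perm_prod (map A [1..<Suc k]) = B 0"
  using assms
proof (induction k)
  case 0
  show ?case by (simp add: perm_prod_def)
next
  case (Suc k)
  have IH: "perm_prod (map (\<lambda>i. B (k - i)) [0..<Suc k]) \<circ> perm_prod (map A [1..<Suc k]) = B 0"
    using Suc.prems by (intro Suc.IH) simp_all
  have "perm_prod (map (\<lambda>i. B (Suc k - i)) [0..<Suc (Suc k)])
      = B (Suc k) \<circ> perm_prod (map (\<lambda>i. B (k - i)) [0..<Suc k])"
    by (simp add: map_upt_Suc perm_prod_Cons del: upt_Suc)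
  moreover have "perm_prod (map A [1..<Suc (Suc k)]) = perm_prod (map A [1..<Suc k]) \<circ> A (Suc k)"
    by (simp add: perm_prod_snoc)
  ultimately have "perm_prod (map (\<lambda>i. B (Suc k - i)) [0..<Suc (Suc k)])
      \<circ> perm_prod (map A [1..<Suc (Suc k)])
    = B (Suc k) \<circ> (perm_prod (map (\<lambda>i. B (k - i)) [0..<Suc k]) \<circ> perm_prod (map A [1..<Suc k])) \<circ> A (Suc k)"
    by (simp only: comp_assoc)
  also have "\<dots> = B (Suc k) \<circ> (B 0 \<circ> A (Suc k))"
    unfolding IH by (simp only: comp_assoc)
  also have "\<dots> = (B (Suc k) \<circ> A (Suc k)) \<circ> B 0"
    using Suc.prems(2)[of "Suc k"] by (simp only: comp_assoc)
  also have "B (Suc k) \<circ> A (Suc k) = id" by (rule Suc.prems(1)) simp_all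
  finally show ?case by simp
qed

text \<open>Replaces the inverse of \<open>u\<close> occurring in \<open>psi\<close> by
  \<open>u\<close> itself in the commutation relation.\<close>

lemma inverse_commute_iff:
  assumes "B \<circ> A = id" "A \<circ> B = id"
  shows "B \<circ> C = C \<circ> B \<longleftrightarrow> A \<circ> C = C \<circ> A"
proof -
  have "g \<circ> C = C \<circ> g" if "f \<circ> C = C \<circ> f" "f \<circ> g = id" "g \<circ> f = id" for f g
  proof
    fix x
    have "f (C (g x)) = C x" using that by (simp add: fun_eq_iff)
    then show "(g \<circ> C) x = (C \<circ> g) x" using that(3) by (metis comp_apply id_apply)
  qed
  then show ?thesis using assms by blast
qed

text \<open>The instance \<open>h = 0\<close> already forces commutation; conversely, commutation
  makes every \<open>psi n 2 (1 + h) u\<close> telescope to its factor \<open>B 0\<close>.\<close>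

lemma stable_at_1_iff_commute:
  assumes u: "u permutes words n 2"
  shows "stable_at n 2 u 1 \<longleftrightarrow>
    pad n 2 0 1 u \<circ> pad n 2 1 0 u = pad n 2 1 0 u \<circ> pad n 2 0 1 u" (is "_ \<longleftrightarrow> ?A0 \<circ> ?A1 = _")
proof -
  let ?B0 = "pad n 2 0 1 (inv u)" and ?B1 = "pad n 2 1 0 (inv u)"
  note A0 = pad_inv[OF u, of 0 1] and A1 = pad_inv[OF u, of 1 0]
  have swap: "?B0 \<circ> ?A1 = ?A1 \<circ> ?B0 \<longleftrightarrow> ?A0 \<circ> ?A1 = ?A1 \<circ> ?A0"
    by (rule inverse_commute_iff[OF A0])
  have "?B0 \<circ> ?A1 = ?A1 \<circ> ?B0" if "stable_at n 2 u 1"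
  proof -
    have "psi n 2 1 u = ?B0"
      using that unfolding stable_at_def by (auto simp: pad_0 psi_def dest: spec[of _ 0])
    then have "?B1 \<circ> ?B0 \<circ> ?A1 = ?B0"
      by (simp add: psi_def perm_prod_def comp_assoc)
    \<comment> \<open>Composing with \<open>?A1\<close> on the left cancels
      \<open>?B1\<close>.\<close>
    then have "?A1 \<circ> ?B1 \<circ> (?B0 \<circ> ?A1) = ?A1 \<circ> ?B0"
      by (simp add: comp_assoc)
    then show ?thesis unfolding A1(2) by simp
  qed
  moreover have "stable_at n 2 u 1" if comm: "?B0 \<circ> ?A1 = ?A1 \<circ> ?B0"
  proof -
    have "psi n 2 (1 + h) u = pad n 2 0 (1 + h) (inv u)" for h
    proof -
      let ?k = "1 + h"
      let ?A = "\<lambda>i. pad n 2 i (?k - i) u" and ?B = "\<lambda>i. pad n 2 i (?k - i) (inv u)"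
      have "?B 0 \<circ> ?A i = ?A i \<circ> ?B 0" if "1 \<le> i" "i \<le> ?k" for i
      \<comment> \<open>Only \<open>i = 1\<close> overlaps the first block and needs the hypothesis;
        for \<open>i \<ge> 2\<close> the blocks are disjoint.\<close>
      proof (cases "i = 1")
        case True
        then show ?thesis
          using pad_overlap_commute[OF permutes_inv[OF u] u comm, of h] by simp
      next
        case False
        then show ?thesis
          using that pad_disjoint_commute[OF permutes_inv[OF u] u, of i ?k] by simp
      qed
      then have "perm_prod (map (\<lambda>i. ?B (?k - i)) [0..<Suc ?k]) \<circ> perm_prod (map ?A [1..<Suc ?k]) = ?B 0"
        by (intro perm_prod_conjugate) (auto simp: pad_inv[OF u])
      moreover have "map (\<lambda>i. ?B (?k - i)) [0..<Suc ?k]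
          = map (\<lambda>i. pad n 2 (?k - i) i (inv u)) [0..<Suc ?k]"
        by (rule map_cong) auto
      ultimately have "perm_prod (map (\<lambda>i. pad n 2 (?k - i) i (inv u)) [0..<Suc ?k])
          \<circ> perm_prod (map ?A [1..<Suc ?k]) = ?B 0"
        by (simp only:)
      then show ?thesis by (simp add: psi_def del: upt_Suc)
    qed
    then show ?thesis by (simp add: stable_at_def pad_0 psi_def)
  qed
  ultimately show ?thesis using swap by blast
qed

text \<open>Since \<open>stable_at\<close> includes \<open>k \<ge> 1\<close>, the value 1 is minimal
  as soon as it is admissible.\<close>

lemma stable_rank_1_iff: "stable_perm n t u \<and> stable_rank n t u = 1 \<longleftrightarrow> stable_at n t u 1"
proof
  assume "stable_perm n t u \<and> stable_rank n t u = 1"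
  then show "stable_at n t u 1"
    unfolding stable_perm_def stable_rank_def by (metis LeastI)
next
  assume *: "stable_at n t u 1"
  then have "(LEAST k. stable_at n t u k) = 1"
    by (rule Least_equality) (simp add: stable_at_def)
  with * show "stable_perm n t u \<and> stable_rank n t u = 1"
    by (auto simp: stable_perm_def stable_rank_def)
qed

section \<open>Permutations preserving the first letter\<close>

text \<open>The two composites send \<open>[x, y, z]\<close> to \<open>[x, f x y, f y z]\<close> and
  \<open>[x, f x y, f (f x y) z]\<close>, so only the last letters need comparing.\<close>

lemma stable_at_1_fibred:
  assumes u: "u permutes words n 2" and f: "\<And>x y. u [x, y] = [x, f x y]"
  shows "stable_at n 2 u 1 \<longleftrightarrow>
    (\<forall>x\<in>{1..n}. \<forall>y\<in>{1..n}. \<forall>z\<in>{1..n}. f (f x y) z = f y z)"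
proof -
  have fin: "f x y \<in> {1..n}" if "x \<in> {1..n}" "y \<in> {1..n}" for x y
    using permutes_in_image[OF u, of "[x, y]"] that by (auto simp: words_def f)
  have 0: "pad n 2 0 1 u [x, y, z] = [x, f x y, z]"
    if "x \<in> {1..n}" "y \<in> {1..n}" "z \<in> {1..n}" for x y z
    using pad_append[of "[]" n 0 "[x,y]" 2 "[z]" 1 u] that by (simp add: words_def f)
  have 1: "pad n 2 1 0 u [x, y, z] = [x, y, f y z]"
    if "x \<in> {1..n}" "y \<in> {1..n}" "z \<in> {1..n}" for x y z
    using pad_append[of "[x]" n 1 "[y,z]" 2 "[]" 0 u] that by (simp add: words_def f)
  have "pad n 2 0 1 u \<circ> pad n 2 1 0 u = pad n 2 1 0 u \<circ> pad n 2 0 1 u \<longleftrightarrow>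
    (\<forall>w\<in>words n 3. pad n 2 0 1 u (pad n 2 1 0 u w) = pad n 2 1 0 u (pad n 2 0 1 u w))"
    \<comment> \<open>Both factors fix every list outside \<open>words n 3\<close>.\<close>
    using pad_outside[of _ n 0 2 1 u] pad_outside[of _ n 1 2 0 u]
    by (auto simp: fun_eq_iff numeral_3_eq_3)
  also have "words n 3 = {[x, y, z] |x y z. x \<in> {1..n} \<and> y \<in> {1..n} \<and> z \<in> {1..n}}"
    by (auto simp: words_def numeral_3_eq_3 length_Suc_conv)
  also have "(\<forall>w\<in>{[x, y, z] |x y z. x \<in> {1..n} \<and> y \<in> {1..n} \<and> z \<in> {1..n}}.
      pad n 2 0 1 u (pad n 2 1 0 u w) = pad n 2 1 0 u (pad n 2 0 1 u w)) \<longleftrightarrow>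
    (\<forall>x\<in>{1..n}. \<forall>y\<in>{1..n}. \<forall>z\<in>{1..n}.
      pad n 2 0 1 u (pad n 2 1 0 u [x, y, z]) = pad n 2 1 0 u (pad n 2 0 1 u [x, y, z]))"
    by blast
  also have "\<dots> \<longleftrightarrow> (\<forall>x\<in>{1..n}. \<forall>y\<in>{1..n}. \<forall>z\<in>{1..n}. f (f x y) z = f y z)"
    by (intro ball_cong refl) (auto simp: 0 1 fin simp del: atLeastAtMost_iff One_nat_def)
  finally show ?thesis using stable_at_1_iff_commute[OF u] by (simp only:)
qed

section \<open>The criterion for two transpositions\<close>

abbreviation two_swaps :: "nat \<Rightarrow> nat \<Rightarrow> nat \<Rightarrow> nat \<Rightarrow> nat \<Rightarrow> nat \<Rightarrow> nat list \<Rightarrow> nat list" where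
  "two_swaps a1 i1 j1 a2 i2 j2 \<equiv> transpose [a1, i1] [a1, j1] \<circ> transpose [a2, i2] [a2, j2]"

lemma two_swaps_apply:
  assumes "a1 \<noteq> a2"
  shows "two_swaps a1 i1 j1 a2 i2 j2 [x, y] =
    [x, (if x = a1 then transpose i1 j1 else if x = a2 then transpose i2 j2 else id) y]"
proof -
  have "transpose [a, i] [a, j] [x, y] = [x, if x = a then transpose i j y else y]"
    for a i j x y :: nat
    by (simp add: transpose_def)
  then show ?thesis using assms by simp
qed

lemma two_swaps_other:
  assumes "\<nexists>x y. w = [x, y]"
  shows "two_swaps a1 i1 j1 a2 i2 j2 w = w"
proof -
  have "w \<noteq> [x, y]" for x y using assms by simp
  then show ?thesis by (simp add: transpose_apply_other)
qed

lemma two_swaps_permutes: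
  assumes "{a1, i1, j1, a2, i2, j2} \<subseteq> {1..n}"
  shows "two_swaps a1 i1 j1 a2 i2 j2 permutes words n 2"
  using assms by (intro permutes_compose permutes_swap_id) (auto simp: words_def)

text \<open>Two letters with the same fibre map \<open>f\<close> are either both outside
  \<open>{a1, a2}\<close> or are \<open>a1\<close> and \<open>a2\<close> themselves; applying this
  to \<open>i1, j1\<close> and \<open>i2, j2\<close> gives the two alternatives.\<close>

lemma stable_at_1_two_swaps_iff:
  assumes n: "{a1, i1, j1, a2, i2, j2} \<subseteq> {1..n}" and ne: "a1 \<noteq> a2" "i1 \<noteq> j1" "i2 \<noteq> j2"
  shows "stable_at n 2 (two_swaps a1 i1 j1 a2 i2 j2) 1 \<longleftrightarrow>
    {a1, a2} \<inter> {i1, j1, i2, j2} = {} \<or> {a1, a2} = {i1, j1, i2, j2}" (is "_ \<longleftrightarrow> ?rhs")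
proof -
  define f where "f x = (if x = a1 then transpose i1 j1 else if x = a2 then transpose i2 j2 else id)" for x
  have f_eqs: "f a1 = transpose i1 j1" "f a2 = transpose i2 j2" using ne by (auto simp: f_def)
  have "stable_at n 2 (two_swaps a1 i1 j1 a2 i2 j2) 1 \<longleftrightarrow>
      (\<forall>x\<in>{1..n}. \<forall>y\<in>{1..n}. \<forall>z\<in>{1..n}. f (f x y) z = f y z)"
    by (rule stable_at_1_fibred[where f = f, OF two_swaps_permutes[OF n]])
      (simp only: two_swaps_apply[OF ne(1)] f_def)
  moreover have ?rhs if *: "\<forall>x\<in>{1..n}. \<forall>y\<in>{1..n}. \<forall>z\<in>{1..n}. f (f x y) z = f y z"
  proof -
    \<comment> \<open>\<open>f a1\<close> sends \<open>i1\<close> to \<open>j1\<close> and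
      \<open>f a2\<close> sends \<open>i2\<close> to \<open>j2\<close>, so \<open>i1\<close> and
      \<open>i2\<close> suffice to tell these maps from the identity.\<close>
    have moved: "f b i1 \<noteq> i1 \<or> f b i2 \<noteq> i2" if "b \<in> {a1, a2}" for b
      using that ne by (auto simp: f_eqs transpose_def)
    have outside: "f b = id" if "b \<notin> {a1, a2}" for b using that by (simp add: f_def)
    \<comment> \<open>The value \<open>f a1 i1 = j1\<close> differs from \<open>i1\<close>, so
      \<open>transpose i2 j2\<close> must exchange \<open>i1\<close> and \<open>j1\<close>.\<close>
    have eq12: "{i1, j1} = {i2, j2}" if "f a1 i1 = f a2 i1" 
      using that ne by (auto simp: f_eqs transpose_def split: if_splits)
    have only_moved: "c \<in> {a1, a2}" if "b \<in> {a1, a2}" "f b i1 = f c i1" "f b i2 = f c i2" for b c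
    proof (rule ccontr)
      assume "c \<notin> {a1, a2}"
      then show False using that moved[of b] outside[of c] by simp
    qed
    have fibre: "{b, c} \<inter> {a1, a2} = {} \<or> {b, c} = {a1, a2} \<and> {i1, j1} = {i2, j2}"
      if bc: "b \<noteq> c" "\<forall>z\<in>{1..n}. f b z = f c z" for b c
    proof -
      have "f b i1 = f c i1" "f b i2 = f c i2" using bc(2) n by auto
      then have same: "b \<in> {a1, a2} \<longleftrightarrow> c \<in> {a1, a2}"
        using only_moved[of b c] only_moved[of c b] by metis
      show ?thesis
      proof (cases "b \<in> {a1, a2}")
        case True
        then have "b = a1 \<and> c = a2 \<or> b = a2 \<and> c = a1" using same bc(1) by blast
        moreover from this have "f a1 i1 = f a2 i1" using \<open>f b i1 = f c i1\<close> by metis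
        ultimately show ?thesis using eq12 by blast
      qed (use same in blast)
    qed
    \<comment> \<open>The hypothesis is used at \<open>x = a1, y = i1\<close> and at
      \<open>x = a2, y = i2\<close>.\<close>
    have "f a1 i1 = j1" "f a2 i2 = j2" by (simp_all add: f_eqs)
    then have "\<forall>z\<in>{1..n}. f i1 z = f j1 z" "\<forall>z\<in>{1..n}. f i2 z = f j2 z"
      using * n by (metis insert_subset)+
    then show ?thesis using fibre[OF ne(2)] fibre[OF ne(3)] by auto
  qed
  moreover have "f (f x y) = f y" if ?rhs for x y
  proof -
    consider (disjoint) "{a1, a2} \<inter> {i1, j1, i2, j2} = {}" | (equal) "{a1, a2} = {i1, j1, i2, j2}"
      using \<open>?rhs\<close> by blast
    then show ?thesis
    proof cases
      case disjoint
      \<comment> \<open>A letter that is moved stays among \<open>i1, j1, i2, j2\<close>, where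
        \<open>f\<close> is the identity.\<close>
      have "f x y = y \<or> {y, f x y} \<subseteq> {i1, j1, i2, j2}" by (auto simp: f_def transpose_def)
      then show ?thesis
      proof
        assume "{y, f x y} \<subseteq> {i1, j1, i2, j2}"
        then have "y \<notin> {a1, a2}" "f x y \<notin> {a1, a2}" using disjoint by blast+
        then show ?thesis by (simp add: f_def)
      qed simp
    next
      case equal
      \<comment> \<open>Each pair is a two-element subset of \<open>{a1, a2}\<close>, hence all of
        it, and both fibre maps become the same transposition, which preserves
        \<open>{a1, a2}\<close>.\<close>
      have "{i, j} = {a1, a2}" if "i \<noteq> j" "{i, j} \<subseteq> {a1, a2}" for i j
        using that by blast
      then have "{i1, j1} = {a1, a2}" "{i2, j2} = {a1, a2}"
        using ne equal by blast+
      then have "transpose i1 j1 = transpose a1 a2" "transpose i2 j2 = transpose a1 a2"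
        by (auto simp: doubleton_eq_iff transpose_commute)
      then have f: "f x = (if x \<in> {a1, a2} then transpose a1 a2 else id)" for x
        by (simp add: f_def)
      have "f x y = y \<or> {y, f x y} \<subseteq> {a1, a2}" by (auto simp: f transpose_def)
      then show ?thesis by (auto simp: f)
    qed
  qed
  ultimately show ?thesis by auto
qed

section \<open>Counting by normal forms\<close>

text \<open>Increasing pairs encode two-element subsets, giving each unordered pair one
  representative.\<close>

definition ord_pairs :: "nat set \<Rightarrow> (nat \<times> nat) set" where
  "ord_pairs X = {(i, j). i \<in> X \<and> j \<in> X \<and> i < j}"

lemma finite_ord_pairs: "finite X \<Longrightarrow> finite (ord_pairs X)"
  by (rule finite_subset[of _ "X \<times> X"]) (auto simp: ord_pairs_def)

lemma card_ord_pairs: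
  assumes "finite X"
  shows "card (ord_pairs X) = card X choose 2"
proof -
  have "bij_betw (\<lambda>(i, j). {i, j}) (ord_pairs X) {B. B \<subseteq> X \<and> card B = 2}"
    unfolding bij_betw_def
  proof
    show "inj_on (\<lambda>(i, j). {i, j}) (ord_pairs X)"
      by (auto simp: inj_on_def ord_pairs_def doubleton_eq_iff)
    show "(\<lambda>(i, j). {i, j}) ` ord_pairs X = {B. B \<subseteq> X \<and> card B = 2}"
    proof (intro equalityI subsetI)
      fix B assume "B \<in> {B. B \<subseteq> X \<and> card B = 2}"
      then obtain i j where "B = {i, j}" "i \<noteq> j" "i \<in> X" "j \<in> X" by (auto simp: card_2_iff)
      then have "B = {min i j, max i j}" "(min i j, max i j) \<in> ord_pairs X"
        by (auto simp: ord_pairs_def min_def max_def)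
      then show "B \<in> (\<lambda>(i, j). {i, j}) ` ord_pairs X" by force
    qed (auto simp: ord_pairs_def)
  qed
  then show ?thesis using n_subsets[OF assms] bij_betw_same_card by fastforce
qed

lemma moved_two_swaps:
  assumes "a1 \<noteq> a2" "i1 \<noteq> j1" "i2 \<noteq> j2"
  shows "two_swaps a1 i1 j1 a2 i2 j2 [x, y] \<noteq> [x, y] \<longleftrightarrow>
    x = a1 \<and> y \<in> {i1, j1} \<or> x = a2 \<and> y \<in> {i2, j2}"
proof -
  have "transpose i j y \<noteq> y \<longleftrightarrow> y \<in> {i, j}" if "i \<noteq> j" for i j
    using that by (auto simp: transpose_def)
  from this[OF assms(2)] this[OF assms(3)] show ?thesis
    unfolding two_swaps_apply[OF assms(1)] using assms(1) by (cases "x = a1") auto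
qed

text \<open>The set of moved words determines the parameters: its first letters give
  \<open>{a1, a2}\<close>, its second letters over each of these give the swapped pair, and the
  order fixes the naming.\<close>

lemma two_swaps_inject:
  assumes eq: "two_swaps a1 i1 j1 a2 i2 j2 = two_swaps b1 k1 l1 b2 k2 l2"
    and lt: "a1 < a2" "i1 < j1" "i2 < j2" "b1 < b2" "k1 < l1" "k2 < l2"
  shows "a1 = b1 \<and> i1 = k1 \<and> j1 = l1 \<and> a2 = b2 \<and> i2 = k2 \<and> j2 = l2"
proof -
  have moved: "x = a1 \<and> y \<in> {i1, j1} \<or> x = a2 \<and> y \<in> {i2, j2} \<longleftrightarrow>
      x = b1 \<and> y \<in> {k1, l1} \<or> x = b2 \<and> y \<in> {k2, l2}" for x y
    using moved_two_swaps[of a1 a2 i1 j1 i2 j2 x y] moved_two_swaps[of b1 b2 k1 l1 k2 l2 x y] lt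
    unfolding eq by simp
  have "{a1, a2} = {b1, b2}" using moved by blast
  then have "a1 = b1" "a2 = b2" using lt by (auto simp: doubleton_eq_iff)
  moreover from this have "{i1, j1} = {k1, l1}" "{i2, j2} = {k2, l2}"
    using moved[of a1] moved[of a2] lt by blast+
  ultimately show ?thesis using lt by (auto simp: doubleton_eq_iff)
qed

lemma two_swaps_commute:
  assumes "a1 \<noteq> a2"
  shows "two_swaps a1 i1 j1 a2 i2 j2 = two_swaps a2 i2 j2 a1 i1 j1"
proof
  fix w
  show "two_swaps a1 i1 j1 a2 i2 j2 w = two_swaps a2 i2 j2 a1 i1 j1 w"
  proof (cases "\<exists>x y. w = [x, y]")
    case True
    then obtain x y where w: "w = [x, y]" by blast
    show ?thesis
      unfolding w two_swaps_apply[OF assms] two_swaps_apply[OF assms[symmetric]]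
      using assms by (cases "x = a1") auto
  next
    case False
    show ?thesis unfolding two_swaps_other[OF False] ..
  qed
qed

lemma card_rank_1_two_swaps:
  "card {u. stable_at n 2 u 1 \<and> (\<exists>a1 i1 j1 a2 i2 j2. {a1, i1, j1, a2, i2, j2} \<subseteq> {1..n} \<and>
      a1 \<noteq> a2 \<and> i1 \<noteq> j1 \<and> i2 \<noteq> j2 \<and> u = two_swaps a1 i1 j1 a2 i2 j2)}
    = (n choose 2) * (((n - 2) choose 2)\<^sup>2 + 1)" (is "card ?S = _")
proof -
  \<comment> \<open>Over each first-letter pair \<open>p\<close>, the product collects the disjoint
    case and the inserted point \<open>(p, p)\<close> is the equal case, where both swapped pairs
    are \<open>p\<close>.\<close>
  define D where "D = (SIGMA p:ord_pairs {1..n}.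
    insert (p, p) (ord_pairs ({1..n} - {fst p, snd p}) \<times> ord_pairs ({1..n} - {fst p, snd p})))"
  define F where "F = (\<lambda>((a1, a2), (i1, j1), (i2, j2)). two_swaps a1 i1 j1 a2 i2 j2)"
  have "?S = F ` D"
  proof (intro equalityI subsetI)
    fix u assume "u \<in> ?S"
    then obtain a1 i1 j1 a2 i2 j2 where stable: "stable_at n 2 u 1"
      and n: "{a1, i1, j1, a2, i2, j2} \<subseteq> {1..n}" and ne: "a1 \<noteq> a2" "i1 \<noteq> j1" "i2 \<noteq> j2"
      and u: "u = two_swaps a1 i1 j1 a2 i2 j2"
      by blast
    \<comment> \<open>Normalisation first orders the letters within each transposition, then the two
      commuting transpositions by first letter.\<close>
    have sort: "\<exists>i' j'. i' < j' \<and> {i', j'} = {i, j} \<and> transpose [a, i] [a, j] = transpose [a, i'] [a, j']"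
      if "i \<noteq> j" for a i j :: nat
      proof (cases "i < j")
        case False
        then show ?thesis
          using that by (intro exI[of _ j] exI[of _ i]) (auto simp: transpose_commute)
      qed blast
    obtain i1' j1' where 1: "i1' < j1'" "{i1', j1'} = {i1, j1}"
        "transpose [a1, i1] [a1, j1] = transpose [a1, i1'] [a1, j1']"
      using sort[OF ne(2)] by blast
    obtain i2' j2' where 2: "i2' < j2'" "{i2', j2'} = {i2, j2}"
        "transpose [a2, i2] [a2, j2] = transpose [a2, i2'] [a2, j2']"
      using sort[OF ne(3)] by blast
    have "\<exists>b1 k1 l1 b2 k2 l2. {b1, k1, l1, b2, k2, l2} \<subseteq> {1..n} \<and> b1 < b2 \<and> k1 < l1 \<and> k2 < l2 \<and>
        u = two_swaps b1 k1 l1 b2 k2 l2"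
    proof (cases "a1 < a2")
      case True
      have "{a1, i1', j1', a2, i2', j2'} \<subseteq> {1..n}" using 1(2) 2(2) n by blast
      then show ?thesis using True 1 2 u by metis
    next
      case False
      have "u = two_swaps a2 i2' j2' a1 i1' j1'"
        using two_swaps_commute[OF ne(1)] 1 2 u by metis
      moreover have "{a2, i2', j2', a1, i1', j1'} \<subseteq> {1..n}" using 1(2) 2(2) n by blast
      ultimately show ?thesis using False ne(1) 1(1) 2(1) by (metis linorder_neqE_nat)
    qed
    then obtain b1 k1 l1 b2 k2 l2 where b: "{b1, k1, l1, b2, k2, l2} \<subseteq> {1..n}"
        "b1 < b2" "k1 < l1" "k2 < l2" and u': "u = two_swaps b1 k1 l1 b2 k2 l2"
      by blast
    have "{b1, b2} \<inter> {k1, l1, k2, l2} = {} \<or> {b1, b2} = {k1, l1, k2, l2}"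
      using stable_at_1_two_swaps_iff[of b1 k1 l1 b2 k2 l2 n] b stable unfolding u' by simp
    then have "((b1, b2), (k1, l1), (k2, l2)) \<in> D"
    proof
      assume "{b1, b2} \<inter> {k1, l1, k2, l2} = {}"
      then have "{k1, l1, k2, l2} \<subseteq> {1..n} - {b1, b2}" using b(1) by blast
      then show ?thesis using b by (simp add: D_def ord_pairs_def)
    next
      assume eq: "{b1, b2} = {k1, l1, k2, l2}"
      \<comment> \<open>\<open>(b1, b2)\<close> is the only increasing pair with entries in
        \<open>{b1, b2}\<close>.\<close>
      have "k = b1 \<and> l = b2" if "k < l" "k \<in> {b1, b2}" "l \<in> {b1, b2}" for k l
        using that b(2) by auto
      from this[OF b(3)] this[OF b(4)] have "k1 = b1" "l1 = b2" "k2 = b1" "l2 = b2"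
        unfolding eq by simp_all
      then show ?thesis using b by (simp add: D_def ord_pairs_def)
    qed
    then show "u \<in> F ` D" unfolding u' by (force simp: F_def)
  next
    fix u assume "u \<in> F ` D"
    then obtain a1 a2 i1 j1 i2 j2 where d: "((a1, a2), (i1, j1), (i2, j2)) \<in> D"
      and u: "u = two_swaps a1 i1 j1 a2 i2 j2"
      by (auto simp: F_def)
    have n: "{a1, i1, j1, a2, i2, j2} \<subseteq> {1..n}" "a1 \<noteq> a2" "i1 \<noteq> j1" "i2 \<noteq> j2"
      "{a1, a2} \<inter> {i1, j1, i2, j2} = {} \<or> {a1, a2} = {i1, j1, i2, j2}"
      using d by (auto simp: D_def ord_pairs_def)
    then show "u \<in> ?S" using stable_at_1_two_swaps_iff[OF n(1-4)] u by blast
  qed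
  moreover have "inj_on F D"
  proof (rule inj_onI)
    fix d e assume "d \<in> D" "e \<in> D" "F d = F e"
    then show "d = e"
      by (cases d; cases e) (auto simp: F_def D_def ord_pairs_def dest!: two_swaps_inject)
  qed
  moreover have "card D = (n choose 2) * (((n - 2) choose 2)\<^sup>2 + 1)"
  proof -
    have "card (insert (p, p) (ord_pairs ({1..n} - {fst p, snd p}) \<times> ord_pairs ({1..n} - {fst p, snd p})))
        = ((n - 2) choose 2)\<^sup>2 + 1" if "p \<in> ord_pairs {1..n}" for p
    proof -
      have "{fst p, snd p} \<subseteq> {1..n}" "card {fst p, snd p} = 2"
        using that by (auto simp: ord_pairs_def)
      then have "card ({1..n} - {fst p, snd p}) = n - 2" by (subst card_Diff_subset) auto
      \<comment> \<open>Hence \<open>(p, p)\<close> is a new element and accounts for the summand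
        1.\<close>
      moreover have "p \<notin> ord_pairs ({1..n} - {fst p, snd p})" by (auto simp: ord_pairs_def)
      ultimately show ?thesis
        by (simp add: finite_ord_pairs card_ord_pairs card_cartesian_product power2_eq_square)
    qed
    then show ?thesis
      by (simp add: D_def card_SigmaI finite_ord_pairs card_ord_pairs)
  qed
  ultimately show ?thesis by (simp add: card_image)
qed

theorem theorem3p7:
  fixes n :: nat
  shows
    "(\<forall>a1\<in>{1..n}. \<forall>a2\<in>{1..n}. \<forall>i1\<in>{1..n}. \<forall>j1\<in>{1..n}. \<forall>i2\<in>{1..n}. \<forall>j2\<in>{1..n}.
        \<forall>u. distinct [[a1, i1], [a1, j1], [a2, i2], [a2, j2]] \<longrightarrow> a1 \<noteq> a2 \<longrightarrow>
          u = transpose [a1, i1] [a1, j1] \<circ> transpose [a2, i2] [a2, j2] \<longrightarrow>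
          ((stable_perm n 2 u \<and> stable_rank n 2 u = 1) \<longleftrightarrow>
             ({a1, a2} \<inter> {i1, j1, i2, j2} = {} \<or> {a1, a2} = {i1, j1, i2, j2})))
     \<and> card {u. u permutes words n 2 \<and> stable_perm n 2 u \<and> stable_rank n 2 u = 1 \<and>
           (\<exists>a1\<in>{1..n}. \<exists>a2\<in>{1..n}. \<exists>i1\<in>{1..n}. \<exists>j1\<in>{1..n}. \<exists>i2\<in>{1..n}. \<exists>j2\<in>{1..n}.
              distinct [[a1, i1], [a1, j1], [a2, i2], [a2, j2]] \<and> a1 \<noteq> a2 \<and>
              u = transpose [a1, i1] [a1, j1] \<circ> transpose [a2, i2] [a2, j2])}
       = (n choose 2) * (((n - 2) choose 2)\<^sup>2 + 1)"
    (is "?criterion \<and> card ?T = _")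
proof
  show ?criterion
  proof (intro ballI allI impI)
    fix a1 a2 i1 j1 i2 j2 u
    assume n: "a1 \<in> {1..n}" "a2 \<in> {1..n}" "i1 \<in> {1..n}" "j1 \<in> {1..n}" "i2 \<in> {1..n}" "j2 \<in> {1..n}"
      and d: "distinct [[a1, i1], [a1, j1], [a2, i2], [a2, j2]]" "a1 \<noteq> a2"
      and u: "u = two_swaps a1 i1 j1 a2 i2 j2"
    show "(stable_perm n 2 u \<and> stable_rank n 2 u = 1) \<longleftrightarrow>
        ({a1, a2} \<inter> {i1, j1, i2, j2} = {} \<or> {a1, a2} = {i1, j1, i2, j2})"
      unfolding stable_rank_1_iff u using n d by (intro stable_at_1_two_swaps_iff) auto
  qed
  let ?S = "{u. stable_at n 2 u 1 \<and> (\<exists>a1 i1 j1 a2 i2 j2. {a1, i1, j1, a2, i2, j2} \<subseteq> {1..n} \<and>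
      a1 \<noteq> a2 \<and> i1 \<noteq> j1 \<and> i2 \<noteq> j2 \<and> u = two_swaps a1 i1 j1 a2 i2 j2)}"
  have "?T = ?S"
  proof (intro equalityI subsetI)
    fix u assume "u \<in> ?T"
    then have "stable_at n 2 u 1" using stable_rank_1_iff by blast
    moreover obtain a1 i1 j1 a2 i2 j2 where "{a1, i1, j1, a2, i2, j2} \<subseteq> {1..n}"
        "distinct [[a1, i1], [a1, j1], [a2, i2], [a2, j2]]" "a1 \<noteq> a2"
        "u = two_swaps a1 i1 j1 a2 i2 j2"
      using \<open>u \<in> ?T\<close> by blast
    \<comment> \<open>Given \<open>a1 \<noteq> a2\<close>, distinctness of the four words amounts to
      these two inequalities.\<close>
    moreover from this have "i1 \<noteq> j1" "i2 \<noteq> j2" by auto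
    ultimately show "u \<in> ?S" by blast
  next
    fix u assume "u \<in> ?S"
    then obtain a1 i1 j1 a2 i2 j2 where stable: "stable_at n 2 u 1"
      and n: "{a1, i1, j1, a2, i2, j2} \<subseteq> {1..n}" and ne: "a1 \<noteq> a2" "i1 \<noteq> j1" "i2 \<noteq> j2"
      and u: "u = two_swaps a1 i1 j1 a2 i2 j2"
      by blast
    have "distinct [[a1, i1], [a1, j1], [a2, i2], [a2, j2]]" using ne by simp
    moreover have "u permutes words n 2" using two_swaps_permutes[OF n] u by simp
    moreover have "stable_perm n 2 u" "stable_rank n 2 u = 1"
      using stable stable_rank_1_iff by blast+
    ultimately show "u \<in> ?T" using n ne(1) u by blast
  qed
  then show "card ?T = (n choose 2) * (((n - 2) choose 2)\<^sup>2 + 1)"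
    using card_rank_1_two_swaps by simp
qed

end
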